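(* Any coarse equivalence between large scale spaces is a weak coarse quotient map. Moreover, the class $\mathcal{E}$ of weak coarse quotient maps satisfies the following two conditions: (LS1) if $f$ is close to $g$ and $f$ is in $\mathcal{E}$, then $g$ is in $\mathcal{E}$; (LS2) if $f$ is a large scale continuous map, and $\phi$ and $\psi$ are coarse equivalences such that the composite $\phi f\psi$ is defined, then $f$ is in $\mathcal{E}$ if and only if $\phi f\psi$ is in $\mathcal{E}$.
   Context: For families of subsets of $X$, $\mathrm{st}(\mathcal{B},\mathcal{U})=\{\mathrm{st}(B,\mathcal{U})\mid B\in\mathcal{B}\}$, where $\mathrm{st}(B,\mathcal{U})$ is the union of the elements of $\mathcal{U}$ that intersect $B$. A large scale structure on a set $X$ is a nonempty set of families of subsets of $X$ (the uniformly bounded families) such that (1) if $\mathcal{B}_1$ is uniformly bounded and each element of $\mathcal{B}_2$ with more than one point is contained in some element of $\mathcal{B}_1$, then $\mathcal{B}_2$ is uniformly bounded; (2) $\mathrm{st}(\mathcal{B}_1,\mathcal{B}_2)$ is uniformly bounded whenever $\mathcal{B}_1,\mathcal{B}_2$ are. A large scale space is a set with a large scale structure. The large scale structure generated by a collection of families is the smallest one containing it. A map $f:X\to Y$ is large scale continuous if $f(\mathcal{U})=\{f(U)\mid U\in\mathcal{U}\}$ is uniformly bounded for every uniformly bounded $\mathcal{U}$. Maps $f,g:X\to Y$ are close if $\{\{f(x),g(x)\}\mid x\in X\}$ is uniformly bounded. A large scale continuous map $f:X\to Y$ is coarsely surjective if $Y\subseteq\mathrm{st}(f(X),\mathcal{V})$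 for some uniformly bounded $\mathcal{V}$ in $Y$; a coarse equivalence if it is coarsely surjective and $\{f^{-1}(V)\mid V\in\mathcal{V}\}$ is uniformly bounded in $X$ for every uniformly bounded $\mathcal{V}$ in $Y$; a weak coarse quotient map if it is coarsely surjective and there is a uniformly bounded cover $\mathcal{V}$ of $Y$ such that the large scale structure of $Y$ is generated by $f(\mathcal{X})\cup\{\mathcal{V}\}$, where $\mathcal{X}$ is the large scale structure of $X$ and $f(\mathcal{X})=\{f(\mathcal{U})\mid\mathcal{U}\in\mathcal{X}\}$. *)

theory Defs
  imports "HOL-Library.FuncSet"
begin

text \<open>A large scale space is a carrier set \<open>X\<close> together with its set \<open>\<X>\<close> of uniformly bounded
  families. A map between carriers \<open>X\<close> and \<open>Y\<close> is a function in \<open>X \<rightarrow> Y\<close>; its values outside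
  \<open>X\<close> play no role in any of the notions below.\<close>

definition star :: "'a set \<Rightarrow> 'a set set \<Rightarrow> 'a set" where
  "star B \<U> = \<Union>{U \<in> \<U>. U \<inter> B \<noteq> {}}"

definition star_family :: "'a set set \<Rightarrow> 'a set set \<Rightarrow> 'a set set" where
  "star_family \<B> \<U> = {star B \<U> |B. B \<in> \<B>}"

definition large_scale_structure :: "'a set \<Rightarrow> 'a set set set \<Rightarrow> bool" where
  "large_scale_structure X \<X> \<longleftrightarrow>
     \<X> \<noteq> {} \<and> \<X> \<subseteq> Pow (Pow X) \<and>
     (\<forall>\<B>\<^sub>1 \<in> \<X>. \<forall>\<B>\<^sub>2 \<in> Pow (Pow X).
        (\<forall>B \<in> \<B>\<^sub>2. (\<exists>x \<in> B. \<exists>y \<in> B. x \<noteq> y) \<longrightarrow> (\<exists>C \<in> \<B>\<^sub>1. B \<subseteq> C)) \<longrightarrow> \<B>\<^sub>2 \<in> \<X>) \<and>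
     (\<forall>\<B>\<^sub>1 \<in> \<X>. \<forall>\<B>\<^sub>2 \<in> \<X>. star_family \<B>\<^sub>1 \<B>\<^sub>2 \<in> \<X>)"

definition generated_structure :: "'a set \<Rightarrow> 'a set set set \<Rightarrow> 'a set set set" where
  "generated_structure X \<C> = \<Inter>{\<X>. large_scale_structure X \<X> \<and> \<C> \<subseteq> \<X>}"

lemma large_scale_structure_Pow_Pow: "large_scale_structure X (Pow (Pow X))"
proof -
  have "star_family \<B>\<^sub>1 \<B>\<^sub>2 \<in> Pow (Pow X)" if "\<B>\<^sub>2 \<in> Pow (Pow X)" for \<B>\<^sub>1 \<B>\<^sub>2
    using that unfolding star_family_def star_def by auto
  then show ?thesis
    unfolding large_scale_structure_def by (intro conjI ballI impI) auto
qed

lemma large_scale_structure_refine: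
  assumes "large_scale_structure X \<X>" "\<B>\<^sub>1 \<in> \<X>" "\<B>\<^sub>2 \<in> Pow (Pow X)"
    "\<forall>B \<in> \<B>\<^sub>2. (\<exists>x \<in> B. \<exists>y \<in> B. x \<noteq> y) \<longrightarrow> (\<exists>C \<in> \<B>\<^sub>1. B \<subseteq> C)"
  shows "\<B>\<^sub>2 \<in> \<X>"
proof -
  have "\<forall>\<B>\<^sub>1 \<in> \<X>. \<forall>\<B>\<^sub>2 \<in> Pow (Pow X).
      (\<forall>B \<in> \<B>\<^sub>2. (\<exists>x \<in> B. \<exists>y \<in> B. x \<noteq> y) \<longrightarrow> (\<exists>C \<in> \<B>\<^sub>1. B \<subseteq> C)) \<longrightarrow> \<B>\<^sub>2 \<in> \<X>"
    using assms(1) unfolding large_scale_structure_def by (elim conjE)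
  from this[rule_format, OF assms(2,3)] assms(4) show ?thesis
    by (metis (no_types))
qed

lemma large_scale_structure_star:
  "\<lbrakk>large_scale_structure X \<X>; \<B>\<^sub>1 \<in> \<X>; \<B>\<^sub>2 \<in> \<X>\<rbrakk> \<Longrightarrow> star_family \<B>\<^sub>1 \<B>\<^sub>2 \<in> \<X>"
  unfolding large_scale_structure_def by (elim conjE) (drule (1) bspec, drule (1) bspec, assumption)

lemma empty_family_uniformly_bounded:
  assumes "large_scale_structure X \<X>"
  shows "{} \<in> \<X>"
proof -
  have "\<X> \<noteq> {}"
    using assms unfolding large_scale_structure_def by (elim conjE)
  then obtain \<B> where "\<B> \<in> \<X>"
    by blast
  then show ?thesis
    by (rule large_scale_structure_refine[OF assms]) simp_all
qed

text \<open>The intersection is indeed the smallest large scale structure containing \<open>\<C>\<close>.\<close>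

lemma generated_structure_least:
  "\<lbrakk>large_scale_structure X \<X>; \<C> \<subseteq> \<X>\<rbrakk> \<Longrightarrow> generated_structure X \<C> \<subseteq> \<X>"
  unfolding generated_structure_def by blast

lemma generated_structure_superset: "\<C> \<subseteq> generated_structure X \<C>"
  unfolding generated_structure_def by blast

lemma large_scale_structure_generated:
  assumes "\<C> \<subseteq> Pow (Pow X)"
  shows "large_scale_structure X (generated_structure X \<C>)"
  unfolding large_scale_structure_def
proof (intro conjI ballI impI)
  show "generated_structure X \<C> \<noteq> {}"
    using empty_family_uniformly_bounded unfolding generated_structure_def by fastforce
  show "generated_structure X \<C> \<subseteq> Pow (Pow X)"
    by (rule generated_structure_least[OF large_scale_structure_Pow_Pow assms])
next
  fix \<B>\<^sub>1 \<B>\<^sub>2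
  assume 1: "\<B>\<^sub>1 \<in> generated_structure X \<C>" "\<B>\<^sub>2 \<in> Pow (Pow X)"
    "\<forall>B \<in> \<B>\<^sub>2. (\<exists>x \<in> B. \<exists>y \<in> B. x \<noteq> y) \<longrightarrow> (\<exists>C \<in> \<B>\<^sub>1. B \<subseteq> C)"
  show "\<B>\<^sub>2 \<in> generated_structure X \<C>"
    unfolding generated_structure_def
  proof (rule InterI)
    fix \<X> assume "\<X> \<in> {\<X>. large_scale_structure X \<X> \<and> \<C> \<subseteq> \<X>}"
    then have "large_scale_structure X \<X>" "\<B>\<^sub>1 \<in> \<X>"
      using 1(1) unfolding generated_structure_def by auto
    then show "\<B>\<^sub>2 \<in> \<X>"
      using 1(2,3) by (rule large_scale_structure_refine)
  qed
next
  fix \<B>\<^sub>1 \<B>\<^sub>2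
  assume "\<B>\<^sub>1 \<in> generated_structure X \<C>" "\<B>\<^sub>2 \<in> generated_structure X \<C>"
  then show "star_family \<B>\<^sub>1 \<B>\<^sub>2 \<in> generated_structure X \<C>"
    unfolding generated_structure_def by (auto intro: large_scale_structure_star)
qed

definition image_family :: "('a \<Rightarrow> 'b) \<Rightarrow> 'a set set \<Rightarrow> 'b set set" where
  "image_family f \<U> = {f ` U |U. U \<in> \<U>}"

definition preimage_family :: "'a set \<Rightarrow> ('a \<Rightarrow> 'b) \<Rightarrow> 'b set set \<Rightarrow> 'a set set" where
  "preimage_family X f \<V> = {f -` V \<inter> X |V. V \<in> \<V>}"

definition large_scale_continuous ::
    "'a set \<Rightarrow> 'a set set set \<Rightarrow> 'b set \<Rightarrow> 'b set set set \<Rightarrow> ('a \<Rightarrow> 'b) \<Rightarrow> bool" where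
  "large_scale_continuous X \<X> Y \<Y> f \<longleftrightarrow>
     f \<in> X \<rightarrow> Y \<and> (\<forall>\<U> \<in> \<X>. image_family f \<U> \<in> \<Y>)"

definition close_maps ::
    "'a set \<Rightarrow> 'b set \<Rightarrow> 'b set set set \<Rightarrow> ('a \<Rightarrow> 'b) \<Rightarrow> ('a \<Rightarrow> 'b) \<Rightarrow> bool" where
  "close_maps X Y \<Y> f g \<longleftrightarrow>
     f \<in> X \<rightarrow> Y \<and> g \<in> X \<rightarrow> Y \<and> {{f x, g x} |x. x \<in> X} \<in> \<Y>"

definition coarsely_surjective ::
    "'a set \<Rightarrow> 'a set set set \<Rightarrow> 'b set \<Rightarrow> 'b set set set \<Rightarrow> ('a \<Rightarrow> 'b) \<Rightarrow> bool" where
  "coarsely_surjective X \<X> Y \<Y> f \<longleftrightarrow>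
     large_scale_continuous X \<X> Y \<Y> f \<and> (\<exists>\<V> \<in> \<Y>. Y \<subseteq> star (f ` X) \<V>)"

definition coarse_equivalence ::
    "'a set \<Rightarrow> 'a set set set \<Rightarrow> 'b set \<Rightarrow> 'b set set set \<Rightarrow> ('a \<Rightarrow> 'b) \<Rightarrow> bool" where
  "coarse_equivalence X \<X> Y \<Y> f \<longleftrightarrow>
     coarsely_surjective X \<X> Y \<Y> f \<and> (\<forall>\<V> \<in> \<Y>. preimage_family X f \<V> \<in> \<X>)"

definition weak_coarse_quotient ::
    "'a set \<Rightarrow> 'a set set set \<Rightarrow> 'b set \<Rightarrow> 'b set set set \<Rightarrow> ('a \<Rightarrow> 'b) \<Rightarrow> bool" where
  "weak_coarse_quotient X \<X> Y \<Y> f \<longleftrightarrow>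
     coarsely_surjective X \<X> Y \<Y> f \<and>
     (\<exists>\<V> \<in> \<Y>. \<Union>\<V> = Y \<and>
        \<Y> = generated_structure Y ({image_family f \<U> |\<U>. \<U> \<in> \<X>} \<union> {\<V>}))"

end

theory Submission imports Defs begin

text \<open>Unfolding generation, \<open>f\<close> is a weak coarse quotient map iff it is coarsely surjective and, for
  some uniformly bounded \<open>\<V>\<close>, every large scale structure on \<open>Y\<close> containing \<open>\<V>\<close> and making \<open>f\<close> large
  scale continuous contains \<open>\<Y>\<close>. Composites are handled by pulling a large scale structure back along
  a map. Conversely, to cancel a coarse equivalence \<open>\<phi> : Y \<rightarrow> Z\<close> on the left, a structure \<open>\<Y>'\<close> on \<open>Y\<close>
  is transported to \<open>Z\<close> by declaring \<open>\<B>\<close> bounded when the sets \<open>\<phi>\<^sup>-\<^sup>1(st(B, \<V>))\<close> with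
  \<open>B \<in> \<B>\<close> form a family in \<open>\<Y>'\<close>, where the cover \<open>\<V>\<close> is so coarse that each of its stars at a point meets \<open>\<phi>(Y)\<close>. No coarse
  inverses are needed.\<close>

section \<open>Stars and closure properties of uniformly bounded families\<close>

lemma starI: "\<lbrakk>U \<in> \<U>; y \<in> U; z \<in> U; z \<in> B\<rbrakk> \<Longrightarrow> y \<in> star B \<U>"
  unfolding star_def by blast

lemma star_mono: "B \<subseteq> C \<Longrightarrow> star B \<U> \<subseteq> star C \<U>"
  unfolding star_def by blast

lemma subset_star: "B \<subseteq> \<Union>\<U> \<Longrightarrow> B \<subseteq> star B \<U>"
  unfolding star_def by blast

lemma uniformly_bounded_subset:
  assumes "large_scale_structure X \<X>" "\<U> \<in> \<X>" "U \<in> \<U>"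
  shows "U \<subseteq> X"
proof -
  have "\<X> \<subseteq> Pow (Pow X)"
    using assms(1) unfolding large_scale_structure_def by (elim conjE)
  then show ?thesis
    using assms(2,3) by blast
qed

text \<open>Condition (1) in its handiest form: domination is asked of every nonempty member, which
  spares the two-point condition and still exempts the empty set.\<close>

lemma uniformly_bounded_refine:
  assumes "large_scale_structure X \<X>" "\<B> \<in> \<X>"
    "\<And>C. C \<in> \<C> \<Longrightarrow> C \<subseteq> X"
    "\<And>C x. \<lbrakk>C \<in> \<C>; x \<in> C\<rbrakk> \<Longrightarrow> \<exists>B \<in> \<B>. C \<subseteq> B"
  shows "\<C> \<in> \<X>"
  by (rule large_scale_structure_refine[OF assms(1,2)]) (use assms(3,4) in blast)+

text \<open>One-point sets are exempt from domination in condition (1), so any uniformly bounded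
  family can be enlarged to a cover.\<close>

lemma uniformly_bounded_add_singletons:
  assumes "large_scale_structure X \<X>" "\<U> \<in> \<X>"
  shows "\<U> \<union> (\<lambda>x. {x}) ` X \<in> \<X>"
  by (rule large_scale_structure_refine[OF assms])
    (use uniformly_bounded_subset[OF assms] in blast)+

text \<open>The axioms provide stars, not unions. Once singletons are added to both families, one
  star family dominates their union.\<close>

lemma uniformly_bounded_Un:
  assumes L: "large_scale_structure X \<X>" and U: "\<U> \<in> \<X>" and V: "\<V> \<in> \<X>"
  shows "\<U> \<union> \<V> \<in> \<X>"
proof -
  let ?U = "\<U> \<union> (\<lambda>x. {x}) ` X" and ?V = "\<V> \<union> (\<lambda>x. {x}) ` X"
  note sub = uniformly_bounded_subset[OF L U] uniformly_bounded_subset[OF L V]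
  have "star_family ?U ?V \<in> \<X>"
    by (intro large_scale_structure_star[OF L] uniformly_bounded_add_singletons[OF L] U V)
  then show ?thesis
  proof (rule uniformly_bounded_refine[OF L])
    fix C x assume C: "C \<in> \<U> \<union> \<V>" "x \<in> C"
    \<comment> \<open>A member of \<open>\<U>\<close> lies in its own star because \<open>?V\<close>
      covers \<open>X\<close>. Any other \<open>C\<close> belongs to \<open>\<V>\<close> and so lies
      in the star of each of its points.\<close>
    have "C \<subseteq> star (if C \<in> \<U> then C else {x}) ?V"
      using C sub unfolding star_def by auto
    moreover have "(if C \<in> \<U> then C else {x}) \<in> ?U"
      using C sub(2)[of C] by auto
    ultimately show "\<exists>B \<in> star_family ?U ?V. C \<subseteq> B"
      unfolding star_family_def by blast
  qed (use sub in blast)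
qed

section \<open>Coarse surjectivity and the minimality form of weak coarse quotient maps\<close>

lemma coarsely_surjectiveD:
  assumes "coarsely_surjective X \<X> Y \<Y> f"
  shows "f \<in> X \<rightarrow> Y" "\<And>\<U>. \<U> \<in> \<X> \<Longrightarrow> image_family f \<U> \<in> \<Y>"
  using assms unfolding coarsely_surjective_def large_scale_continuous_def by auto

lemma coarsely_surjective_obtains:
  assumes "coarsely_surjective X \<X> Y \<Y> f"
  obtains \<V> where "\<V> \<in> \<Y>" "\<And>y. y \<in> Y \<Longrightarrow> \<exists>V \<in> \<V>. \<exists>x \<in> X. y \<in> V \<and> f x \<in> V"
proof -
  obtain \<V> where "\<V> \<in> \<Y>" "Y \<subseteq> star (f ` X) \<V>"
    using assms unfolding coarsely_surjective_def by blast
  then show thesis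
    by (intro that[of \<V>]) (auto simp: star_def; blast)+
qed

lemma coarsely_surjectiveI:
  assumes "f \<in> X \<rightarrow> Y" "\<And>\<U>. \<U> \<in> \<X> \<Longrightarrow> image_family f \<U> \<in> \<Y>" "\<V> \<in> \<Y>"
    "\<And>y. y \<in> Y \<Longrightarrow> \<exists>V \<in> \<V>. \<exists>x \<in> X. y \<in> V \<and> f x \<in> V"
  shows "coarsely_surjective X \<X> Y \<Y> f"
proof -
  have "Y \<subseteq> star (f ` X) \<V>"
  proof
    fix y assume "y \<in> Y"
    then obtain V x where "V \<in> \<V>" "x \<in> X" "y \<in> V" "f x \<in> V"
      using assms(4) by blast
    then show "y \<in> star (f ` X) \<V>"
      by (intro starI[of V _ y "f x"]) auto
  qed
  then show ?thesis
    using assms(1-3) unfolding coarsely_surjective_def large_scale_continuous_def by blast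
qed

text \<open>Adding singletons to \<open>\<V>\<close> yields the cover that the definition demands. A
  structure containing the enlarged family contains \<open>\<V>\<close> by refinement, so
  \<open>min\<close> applies to it.\<close>

lemma weak_coarse_quotientI:
  assumes L: "large_scale_structure Y \<Y>" and f: "coarsely_surjective X \<X> Y \<Y> f"
    and V: "\<V> \<in> \<Y>"
    and min: "\<And>\<Y>'. \<lbrakk>large_scale_structure Y \<Y>'; \<V> \<in> \<Y>'; \<And>\<U>. \<U> \<in> \<X> \<Longrightarrow> image_family f \<U> \<in> \<Y>'\<rbrakk>
      \<Longrightarrow> \<Y> \<subseteq> \<Y>'"
  shows "weak_coarse_quotient X \<X> Y \<Y> f"
proof -
  define \<V>' where "\<V>' = \<V> \<union> (\<lambda>y. {y}) ` Y"
  let ?C = "{image_family f \<U> |\<U>. \<U> \<in> \<X>} \<union> {\<V>'}"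
  have V': "\<V>' \<in> \<Y>"
    unfolding \<V>'_def by (rule uniformly_bounded_add_singletons[OF L V])
  have cover: "\<Union>\<V>' = Y"
    using uniformly_bounded_subset[OF L V] unfolding \<V>'_def by auto
  have sub: "?C \<subseteq> \<Y>"
    using V' coarsely_surjectiveD(2)[OF f] by auto
  have "\<Y> \<subseteq> \<Y>'" if L': "large_scale_structure Y \<Y>'" and C: "?C \<subseteq> \<Y>'" for \<Y>'
  proof (rule min[OF L'])
    have "\<V>' \<in> \<Y>'"
      using C by blast
    then show "\<V> \<in> \<Y>'"
      by (rule uniformly_bounded_refine[OF L'])
        (use uniformly_bounded_subset[OF L V] in \<open>auto simp: \<V>'_def\<close>)
  qed (use C in blast)
  then have "\<Y> \<subseteq> generated_structure Y ?C"
    unfolding generated_structure_def by blast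
  then have "\<Y> = generated_structure Y ?C"
    using generated_structure_least[OF L sub] by (rule equalityI)
  then show ?thesis
    unfolding weak_coarse_quotient_def using f V' cover by blast
qed

lemma weak_coarse_quotient_obtains:
  assumes "weak_coarse_quotient X \<X> Y \<Y> f"
  obtains \<V> where "coarsely_surjective X \<X> Y \<Y> f" "\<V> \<in> \<Y>" "\<Union>\<V> = Y"
    "\<And>\<Y>'. \<lbrakk>large_scale_structure Y \<Y>'; \<V> \<in> \<Y>'; \<And>\<U>. \<U> \<in> \<X> \<Longrightarrow> image_family f \<U> \<in> \<Y>'\<rbrakk>
      \<Longrightarrow> \<Y> \<subseteq> \<Y>'"
proof -
  obtain \<V> where *: "\<V> \<in> \<Y>" "\<Union>\<V> = Y" and
    gen: "\<Y> = generated_structure Y ({image_family f \<U> |\<U>. \<U> \<in> \<X>} \<union> {\<V>})"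
    using assms unfolding weak_coarse_quotient_def by blast
  show thesis
  proof (rule that[OF _ *])
    show "coarsely_surjective X \<X> Y \<Y> f"
      using assms unfolding weak_coarse_quotient_def by blast
  next
    fix \<Y>' assume "large_scale_structure Y \<Y>'" "\<V> \<in> \<Y>'"
      "\<And>\<U>. \<U> \<in> \<X> \<Longrightarrow> image_family f \<U> \<in> \<Y>'"
    then have "generated_structure Y ({image_family f \<U> |\<U>. \<U> \<in> \<X>} \<union> {\<V>}) \<subseteq> \<Y>'"
      by (intro generated_structure_least) auto
    then show "\<Y> \<subseteq> \<Y>'"
      using gen by simp
  qed
qed

section \<open>Coarse equivalences are weak coarse quotient maps\<close>

lemma coarse_equivalence_imp_weak_coarse_quotient:
  assumes L: "large_scale_structure Y \<Y>" and f: "coarse_equivalence X \<X> Y \<Y> f"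
  shows "weak_coarse_quotient X \<X> Y \<Y> f"
proof -
  have cs: "coarsely_surjective X \<X> Y \<Y> f" and
    pre: "\<And>\<V>. \<V> \<in> \<Y> \<Longrightarrow> preimage_family X f \<V> \<in> \<X>"
    using f unfolding coarse_equivalence_def by auto
  obtain \<V> where V: "\<V> \<in> \<Y>" and
    hit: "\<And>y. y \<in> Y \<Longrightarrow> \<exists>V \<in> \<V>. \<exists>x \<in> X. y \<in> V \<and> f x \<in> V"
    using coarsely_surjective_obtains[OF cs] by blast
  show ?thesis
  proof (rule weak_coarse_quotientI[OF L cs V], rule subsetI)
    fix \<Y>' \<B>
    assume L': "large_scale_structure Y \<Y>'" and V': "\<V> \<in> \<Y>'" and
      im: "\<And>\<U>. \<U> \<in> \<X> \<Longrightarrow> image_family f \<U> \<in> \<Y>'" and B: "\<B> \<in> \<Y>"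
    \<comment> \<open>A set \<open>B\<close> may miss \<open>f(X)\<close> entirely, so it is
      thickened by \<open>\<V>\<close> before its preimage is taken. A further star with
      \<open>\<V>\<close> then recovers \<open>B\<close>, since each of its points shares a member
      of \<open>\<V>\<close> with a point of \<open>f(X)\<close>, and that point lies in
      \<open>star B \<V>\<close>.\<close>
    let ?F = "image_family f (preimage_family X f (star_family \<B> \<V>))"
    have "star_family ?F \<V> \<in> \<Y>'"
      by (intro large_scale_structure_star[OF L'] im pre large_scale_structure_star[OF L] B V V')
    then show "\<B> \<in> \<Y>'"
    proof (rule uniformly_bounded_refine[OF L'])
      fix B assume "B \<in> \<B>"
      then show BY: "B \<subseteq> Y"
        by (rule uniformly_bounded_subset[OF L B])
      have "B \<subseteq> star (f ` (f -` star B \<V> \<inter> X)) \<V>"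
      proof
        fix y assume y: "y \<in> B"
        then obtain V x where Vx: "V \<in> \<V>" "x \<in> X" "y \<in> V" "f x \<in> V"
          using hit BY by blast
        then have "f x \<in> star B \<V>"
          using y by (intro starI)
        then show "y \<in> star (f ` (f -` star B \<V> \<inter> X)) \<V>"
          using Vx by (intro starI[OF Vx(1,3,4)]) auto
      qed
      then show "\<exists>C \<in> star_family ?F \<V>. B \<subseteq> C"
        using \<open>B \<in> \<B>\<close> unfolding star_family_def image_family_def preimage_family_def by blast
    qed
  qed
qed

section \<open>Invariance under closeness (LS1)\<close>

text \<open>The pair \<open>{f u, g u}\<close> meets \<open>f(U)\<close>, so \<open>g(U)\<close>
  lies in the star of \<open>f(U)\<close>. Only membership of the closeness family in
  \<open>\<Y>\<close> is assumed, so the argument also serves competing structures on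
  \<open>Y\<close>.\<close>

lemma image_family_close:
  assumes L: "large_scale_structure Y \<Y>" and C: "{{f x, g x} |x. x \<in> X} \<in> \<Y>"
    and f: "image_family f \<U> \<in> \<Y>" and U: "\<And>U. U \<in> \<U> \<Longrightarrow> U \<subseteq> X" and g: "g \<in> X \<rightarrow> Y"
  shows "image_family g \<U> \<in> \<Y>"
proof (rule uniformly_bounded_refine[OF L large_scale_structure_star[OF L f C]])
  fix D assume "D \<in> image_family g \<U>"
  then obtain U where D: "D = g ` U" and "U \<in> \<U>"
    unfolding image_family_def by blast
  then show "D \<subseteq> Y"
    using U g by blast
  have "g u \<in> star (f ` U) {{f x, g x} |x. x \<in> X}" if "u \<in> U" for u
    using that U[OF \<open>U \<in> \<U>\<close>] by (intro starI[of "{f u, g u}" _ _ "f u"]) auto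
  then have "D \<subseteq> star (f ` U) {{f x, g x} |x. x \<in> X}"
    unfolding D by blast
  then show "\<exists>B \<in> star_family (image_family f \<U>) {{f x, g x} |x. x \<in> X}. D \<subseteq> B"
    using \<open>U \<in> \<U>\<close> unfolding star_family_def image_family_def by blast
qed

lemma weak_coarse_quotient_close:
  assumes LX: "large_scale_structure X \<X>" and L: "large_scale_structure Y \<Y>"
    and close: "close_maps X Y \<Y> f g" and wcq: "weak_coarse_quotient X \<X> Y \<Y> f"
  shows "weak_coarse_quotient X \<X> Y \<Y> g"
proof -
  let ?C = "{{f x, g x} |x. x \<in> X}"
  have f: "f \<in> X \<rightarrow> Y" and g: "g \<in> X \<rightarrow> Y" and C: "?C \<in> \<Y>"
    using close unfolding close_maps_def by auto
  have C_sym: "{{g x, f x} |x. x \<in> X} = ?C"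
    by (simp add: insert_commute)
  obtain \<V> where cs: "coarsely_surjective X \<X> Y \<Y> f" and V: "\<V> \<in> \<Y>" and cover: "\<Union>\<V> = Y" and
    min: "\<And>\<Y>'. \<lbrakk>large_scale_structure Y \<Y>'; \<V> \<in> \<Y>'; \<And>\<U>. \<U> \<in> \<X> \<Longrightarrow> image_family f \<U> \<in> \<Y>'\<rbrakk>
      \<Longrightarrow> \<Y> \<subseteq> \<Y>'"
    using weak_coarse_quotient_obtains[OF wcq] by blast
  obtain \<W> where W: "\<W> \<in> \<Y>" and
    hit: "\<And>y. y \<in> Y \<Longrightarrow> \<exists>V \<in> \<W>. \<exists>x \<in> X. y \<in> V \<and> f x \<in> V"
    using coarsely_surjective_obtains[OF cs] by blast
  \<comment> \<open>Including the closeness family in the witness for \<open>g\<close> puts it into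
    every competing structure, where images under \<open>f\<close> and \<open>g\<close> are then
    bounded together.\<close>
  let ?CV = "?C \<union> \<V>"
  have CV: "?CV \<in> \<Y>"
    by (rule uniformly_bounded_Un[OF L C V])
  have "coarsely_surjective X \<X> Y \<Y> g"
  proof (rule coarsely_surjectiveI[OF g])
    show "image_family g \<U> \<in> \<Y>" if "\<U> \<in> \<X>" for \<U>
      using that
      by (intro image_family_close[OF L C _ _ g] coarsely_surjectiveD(2)[OF cs]
          uniformly_bounded_subset[OF LX])
    show "star_family \<W> ?CV \<in> \<Y>"
      by (rule large_scale_structure_star[OF L W CV])
    fix y assume "y \<in> Y"
    then obtain V x where Vx: "V \<in> \<W>" "x \<in> X" "y \<in> V" "f x \<in> V"
      using hit by blast
    have "g x \<in> star V ?CV"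
      using Vx by (intro starI[of "{f x, g x}" _ _ "f x"]) auto
    moreover have "y \<in> star V ?CV"
      using subset_star[of V ?CV] uniformly_bounded_subset[OF L W Vx(1)] cover Vx(3) by auto
    ultimately show "\<exists>V \<in> star_family \<W> ?CV. \<exists>x \<in> X. y \<in> V \<and> g x \<in> V"
      using Vx unfolding star_family_def by blast
  qed
  then show ?thesis
  proof (rule weak_coarse_quotientI[OF L _ CV])
    fix \<Y>' assume L': "large_scale_structure Y \<Y>'" and CV': "?CV \<in> \<Y>'" and
      im: "\<And>\<U>. \<U> \<in> \<X> \<Longrightarrow> image_family g \<U> \<in> \<Y>'"
    have V': "\<V> \<in> \<Y>'"
      using uniformly_bounded_refine[OF L' CV'] uniformly_bounded_subset[OF L V] by blast
    have C': "{{g x, f x} |x. x \<in> X} \<in> \<Y>'"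
      unfolding C_sym
      using uniformly_bounded_refine[OF L' CV'] uniformly_bounded_subset[OF L C] by blast
    show "\<Y> \<subseteq> \<Y>'"
      \<comment> \<open>Here closeness is used in the reverse direction, from \<open>g\<close> to
        \<open>f\<close>.\<close>
      by (rule min[OF L' V'])
        (intro image_family_close[OF L' C' _ _ f] im uniformly_bounded_subset[OF LX])
  qed
qed

section \<open>Pullback structures and composition\<close>

text \<open>This is the largest structure on \<open>Y\<close> making \<open>g\<close> large scale
  continuous. The star condition holds because \<open>g\<close> maps the star of \<open>B\<close>
  into the star of \<open>g(B)\<close> with respect to the image family.\<close>

lemma large_scale_structure_pullback:
  assumes L: "large_scale_structure Z \<Z>" and g: "g \<in> Y \<rightarrow> Z"
  shows "large_scale_structure Y {\<B> \<in> Pow (Pow Y). image_family g \<B> \<in> \<Z>}" (is "large_scale_structure Y ?P")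
  unfolding large_scale_structure_def
proof (intro conjI ballI impI)
  show "?P \<noteq> {}"
    using empty_family_uniformly_bounded[OF L] unfolding image_family_def by auto
next
  fix \<B> \<C> assume B: "\<B> \<in> ?P" and C: "\<C> \<in> Pow (Pow Y)" and
    ref: "\<forall>C \<in> \<C>. (\<exists>x \<in> C. \<exists>y \<in> C. x \<noteq> y) \<longrightarrow> (\<exists>B \<in> \<B>. C \<subseteq> B)"
  have "image_family g \<C> \<in> \<Z>"
  proof (rule large_scale_structure_refine[OF L])
    show "image_family g \<B> \<in> \<Z>"
      using B by blast
    show "image_family g \<C> \<in> Pow (Pow Z)"
      using C g unfolding image_family_def by blast
    show "\<forall>D \<in> image_family g \<C>. (\<exists>x \<in> D. \<exists>y \<in> D. x \<noteq> y) \<longrightarrow> (\<exists>E \<in> image_family g \<B>. D \<subseteq> E)"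
    proof (intro ballI impI)
      fix D assume "D \<in> image_family g \<C>" and two: "\<exists>x \<in> D. \<exists>y \<in> D. x \<noteq> y"
      then obtain C where D: "D = g ` C" and "C \<in> \<C>"
        unfolding image_family_def by blast
      \<comment> \<open>Two distinct points of an image have distinct preimages, so one-point
        members of \<open>\<C>\<close> impose nothing on the images.\<close>
      then have "\<exists>x \<in> C. \<exists>y \<in> C. x \<noteq> y"
        using two by (metis imageE)
      then obtain B where "B \<in> \<B>" "C \<subseteq> B"
        using ref \<open>C \<in> \<C>\<close> by blast
      then show "\<exists>E \<in> image_family g \<B>. D \<subseteq> E"
        unfolding D image_family_def by blast
    qed
  qed
  then show "\<C> \<in> ?P"
    using C by blast
next
  fix \<B> \<C> assume B: "\<B> \<in> ?P" and C: "\<C> \<in> ?P"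
  have st: "star B \<C> \<subseteq> Y" for B
    using C unfolding star_def by blast
  have "star_family (image_family g \<B>) (image_family g \<C>) \<in> \<Z>"
    using B C by (intro large_scale_structure_star[OF L]) auto
  then have "image_family g (star_family \<B> \<C>) \<in> \<Z>"
  proof (rule uniformly_bounded_refine[OF L])
    fix D assume "D \<in> image_family g (star_family \<B> \<C>)"
    then obtain B where D: "D = g ` star B \<C>" and "B \<in> \<B>"
      unfolding image_family_def star_family_def by blast
    show "D \<subseteq> Z"
      using st g unfolding D by blast
    have "D \<subseteq> star (g ` B) (image_family g \<C>)"
      unfolding D star_def image_family_def by blast
    then show "\<exists>E \<in> star_family (image_family g \<B>) (image_family g \<C>). D \<subseteq> E"
      using \<open>B \<in> \<B>\<close> unfolding star_family_def image_family_def by blast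
  qed
  then show "star_family \<B> \<C> \<in> ?P"
    using st unfolding star_family_def by blast
qed blast

lemma image_family_comp: "image_family (g \<circ> f) \<U> = image_family g (image_family f \<U>)"
  unfolding image_family_def by (auto simp: image_comp)

lemma weak_coarse_quotient_comp:
  assumes LY: "large_scale_structure Y \<Y>" and LZ: "large_scale_structure Z \<Z>"
    and f: "weak_coarse_quotient X \<X> Y \<Y> f" and g: "weak_coarse_quotient Y \<Y> Z \<Z> g"
  shows "weak_coarse_quotient X \<X> Z \<Z> (g \<circ> f)"
proof -
  obtain \<V> where csf: "coarsely_surjective X \<X> Y \<Y> f" and V: "\<V> \<in> \<Y>" and
    minf: "\<And>\<Y>'. \<lbrakk>large_scale_structure Y \<Y>'; \<V> \<in> \<Y>'; \<And>\<U>. \<U> \<in> \<X> \<Longrightarrow> image_family f \<U> \<in> \<Y>'\<rbrakk>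
      \<Longrightarrow> \<Y> \<subseteq> \<Y>'"
    using weak_coarse_quotient_obtains[OF f] by blast
  obtain \<W> where csg: "coarsely_surjective Y \<Y> Z \<Z> g" and W: "\<W> \<in> \<Z>" and
    ming: "\<And>\<Z>'. \<lbrakk>large_scale_structure Z \<Z>'; \<W> \<in> \<Z>'; \<And>\<U>. \<U> \<in> \<Y> \<Longrightarrow> image_family g \<U> \<in> \<Z>'\<rbrakk>
      \<Longrightarrow> \<Z> \<subseteq> \<Z>'"
    using weak_coarse_quotient_obtains[OF g] by blast
  note fD = coarsely_surjectiveD[OF csf] and gD = coarsely_surjectiveD[OF csg]
  obtain \<A> where A: "\<A> \<in> \<Y>" and
    hitf: "\<And>y. y \<in> Y \<Longrightarrow> \<exists>V \<in> \<A>. \<exists>x \<in> X. y \<in> V \<and> f x \<in> V"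
    using coarsely_surjective_obtains[OF csf] by blast
  obtain \<B> where B: "\<B> \<in> \<Z>" and
    hitg: "\<And>z. z \<in> Z \<Longrightarrow> \<exists>V \<in> \<B>. \<exists>y \<in> Y. z \<in> V \<and> g y \<in> V"
    using coarsely_surjective_obtains[OF csg] by blast
  \<comment> \<open>\<open>?A\<close> serves coarse surjectivity of the composite, and
    \<open>?VW\<close> is its generating witness: \<open>g(\<V>)\<close> lets the pullback meet the
    condition for \<open>f\<close>, and \<open>\<W>\<close> the one for \<open>g\<close>.\<close>
  let ?A = "image_family g \<A>" and ?VW = "image_family g \<V> \<union> \<W>"
  have VW: "?VW \<in> \<Z>"
    by (intro uniformly_bounded_Un[OF LZ] gD(2) V W)
  have "coarsely_surjective X \<X> Z \<Z> (g \<circ> f)"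
  proof (rule coarsely_surjectiveI)
    show "g \<circ> f \<in> X \<rightarrow> Z"
      using fD(1) gD(1) by auto
    show "image_family (g \<circ> f) \<U> \<in> \<Z>" if "\<U> \<in> \<X>" for \<U>
      unfolding image_family_comp by (intro gD(2) fD(2) that)
    show "star_family \<B> (?A \<union> \<B>) \<in> \<Z>"
      by (intro large_scale_structure_star[OF LZ] uniformly_bounded_Un[OF LZ] gD(2) A B)
    fix z assume "z \<in> Z"
    then obtain S y where S: "S \<in> \<B>" "y \<in> Y" "z \<in> S" "g y \<in> S"
      using hitg by blast
    obtain T x where T: "T \<in> \<A>" "x \<in> X" "y \<in> T" "f x \<in> T"
      using hitf[OF S(2)] by blast
    have "z \<in> star S (?A \<union> \<B>)"
      using S by (intro starI[of S _ _ z]) auto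
    moreover have "(g \<circ> f) x \<in> star S (?A \<union> \<B>)"
      using S T by (intro starI[of "g ` T" _ _ "g y"]) (auto simp: image_family_def)
    ultimately show "\<exists>V \<in> star_family \<B> (?A \<union> \<B>). \<exists>x \<in> X. z \<in> V \<and> (g \<circ> f) x \<in> V"
      using S(1) T(2) unfolding star_family_def by blast
  qed
  then show ?thesis
  proof (rule weak_coarse_quotientI[OF LZ _ VW])
    fix \<Z>' assume L': "large_scale_structure Z \<Z>'" and VW': "?VW \<in> \<Z>'" and
      im: "\<And>\<U>. \<U> \<in> \<X> \<Longrightarrow> image_family (g \<circ> f) \<U> \<in> \<Z>'"
    have W': "\<W> \<in> \<Z>'" and V': "image_family g \<V> \<in> \<Z>'"
      using uniformly_bounded_refine[OF L' VW'] uniformly_bounded_subset[OF L' VW'] by blast+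
    have sub: "\<U> \<in> Pow (Pow Y)" if "\<U> \<in> \<Y>" for \<U>
      using uniformly_bounded_subset[OF LY that] by blast
    \<comment> \<open>Minimality for \<open>f\<close>, applied to the pullback of
      \<open>\<Z>'\<close>, says exactly that \<open>g\<close> sends families of \<open>\<Y>\<close>
      into \<open>\<Z>'\<close>. This is the premise of minimality for \<open>g\<close>.\<close>
    have "\<Y> \<subseteq> {\<U> \<in> Pow (Pow Y). image_family g \<U> \<in> \<Z>'}"
      using sub V V' fD(2) im unfolding image_family_comp
      by (intro minf large_scale_structure_pullback[OF L' gD(1)]) blast+
    then show "\<Z> \<subseteq> \<Z>'"
      by (intro ming[OF L' W']) blast
  qed
qed

section \<open>Cancellation on the right and on the left\<close>

text \<open>Every image family under \<open>f \<circ> \<psi>\<close> is an image under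
  \<open>f\<close> of a family in \<open>\<X>\<close>, so the same witness \<open>\<V>\<close> works
  for \<open>f\<close>.\<close>

lemma weak_coarse_quotient_cancel_right:
  assumes LY: "large_scale_structure Y \<Y>" and psi: "large_scale_continuous W \<W> X \<X> \<psi>"
    and f: "large_scale_continuous X \<X> Y \<Y> f" and wcq: "weak_coarse_quotient W \<W> Y \<Y> (f \<circ> \<psi>)"
  shows "weak_coarse_quotient X \<X> Y \<Y> f"
proof -
  have psiD: "\<psi> \<in> W \<rightarrow> X" "\<And>\<U>. \<U> \<in> \<W> \<Longrightarrow> image_family \<psi> \<U> \<in> \<X>"
    using psi unfolding large_scale_continuous_def by auto
  obtain \<V> where cs: "coarsely_surjective W \<W> Y \<Y> (f \<circ> \<psi>)" and V: "\<V> \<in> \<Y>" and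
    min: "\<And>\<Y>'. \<lbrakk>large_scale_structure Y \<Y>'; \<V> \<in> \<Y>'; \<And>\<U>. \<U> \<in> \<W> \<Longrightarrow> image_family (f \<circ> \<psi>) \<U> \<in> \<Y>'\<rbrakk>
      \<Longrightarrow> \<Y> \<subseteq> \<Y>'"
    using weak_coarse_quotient_obtains[OF wcq] by blast
  obtain \<A> where "\<A> \<in> \<Y>" "Y \<subseteq> star ((f \<circ> \<psi>) ` W) \<A>"
    using cs unfolding coarsely_surjective_def by blast
  moreover have "star ((f \<circ> \<psi>) ` W) \<A> \<subseteq> star (f ` X) \<A>"
    using psiD(1) by (intro star_mono) auto
  ultimately have "coarsely_surjective X \<X> Y \<Y> f"
    using f unfolding coarsely_surjective_def by blast
  then show ?thesis
    by (rule weak_coarse_quotientI[OF LY _ V])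
      (use min psiD(2) in \<open>simp add: image_family_comp\<close>)
qed

text \<open>Plain preimages would fail the star condition, since a member of \<open>\<C>\<close> may
  meet \<open>B\<close> outside \<open>\<phi>(Y)\<close>. Thickening by \<open>\<V>\<close> and
  assumption \<open>hit\<close> supply a nearby point of \<open>\<phi>(Y)\<close>.\<close>

lemma large_scale_structure_pushforward:
  assumes L: "large_scale_structure Y \<Y>" and cover: "\<Union>\<V> = Z"
    and hit: "\<And>z. z \<in> Z \<Longrightarrow> \<exists>V \<in> \<V>. \<exists>y \<in> Y. z \<in> V \<and> \<phi> y \<in> V"
    and V: "preimage_family Y \<phi> (star_family \<V> \<V>) \<in> \<Y>"
  shows "large_scale_structure Z
    {\<B> \<in> Pow (Pow Z). preimage_family Y \<phi> (star_family \<B> \<V>) \<in> \<Y>}" (is "large_scale_structure Z ?P")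
  unfolding large_scale_structure_def
proof (intro conjI ballI impI)
  show "?P \<noteq> {}"
    using empty_family_uniformly_bounded[OF L] unfolding preimage_family_def star_family_def by auto
next
  fix \<B> \<C> assume B: "\<B> \<in> ?P" and C: "\<C> \<in> Pow (Pow Z)" and
    ref: "\<forall>C \<in> \<C>. (\<exists>x \<in> C. \<exists>y \<in> C. x \<noteq> y) \<longrightarrow> (\<exists>B \<in> \<B>. C \<subseteq> B)"
  have "preimage_family Y \<phi> (star_family \<B> \<V>) \<union> preimage_family Y \<phi> (star_family \<V> \<V>) \<in> \<Y>"
    using B V by (intro uniformly_bounded_Un[OF L]) auto
  then have "preimage_family Y \<phi> (star_family \<C> \<V>) \<in> \<Y>"
  proof (rule uniformly_bounded_refine[OF L])
    fix D y assume "D \<in> preimage_family Y \<phi> (star_family \<C> \<V>)" and y: "y \<in> D"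
    then obtain C where D: "D = \<phi> -` star C \<V> \<inter> Y" and "C \<in> \<C>"
      unfolding preimage_family_def star_family_def by blast
    obtain z where z: "z \<in> C"
      using y unfolding D star_def by blast
    \<comment> \<open>A one-point \<open>C\<close> is not dominated by \<open>\<B>\<close>, yet its
      thickening can have a large preimage. The cover \<open>\<V>\<close> bounds it through
      assumption \<open>V\<close>.\<close>
    have "\<exists>B \<in> \<B> \<union> \<V>. C \<subseteq> B"
    proof (cases "\<exists>x \<in> C. \<exists>y \<in> C. x \<noteq> y")
      case True
      then show ?thesis
        using ref \<open>C \<in> \<C>\<close> by blast
    next
      case False
      then have "C = {z}"
        using z by blast
      then show ?thesis
        using C \<open>C \<in> \<C>\<close> cover by blast
    qed
    then obtain B where "B \<in> \<B> \<union> \<V>" "C \<subseteq> B"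
      by blast
    then have "D \<subseteq> \<phi> -` star B \<V> \<inter> Y"
      unfolding D using star_mono[of C B \<V>] by blast
    then show "\<exists>E \<in> preimage_family Y \<phi> (star_family \<B> \<V>) \<union> preimage_family Y \<phi> (star_family \<V> \<V>). D \<subseteq> E"
      using \<open>B \<in> \<B> \<union> \<V>\<close> unfolding preimage_family_def star_family_def by blast
  qed (auto simp: preimage_family_def)
  then show "\<C> \<in> ?P"
    using C by blast
next
  fix \<B> \<C> assume B: "\<B> \<in> ?P" and C: "\<C> \<in> ?P"
  let ?B = "preimage_family Y \<phi> (star_family \<B> \<V>)" and ?C = "preimage_family Y \<phi> (star_family \<C> \<V>)"
  have "star_family ?B ?C \<in> \<Y>"
    using B C by (intro large_scale_structure_star[OF L]) auto
  then have "preimage_family Y \<phi> (star_family (star_family \<B> \<C>) \<V>) \<in> \<Y>"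
  proof (rule uniformly_bounded_refine[OF L])
    fix D assume "D \<in> preimage_family Y \<phi> (star_family (star_family \<B> \<C>) \<V>)"
    then obtain B where D: "D = \<phi> -` star (star B \<C>) \<V> \<inter> Y" and "B \<in> \<B>"
      unfolding preimage_family_def star_family_def by blast
    have "D \<subseteq> star (\<phi> -` star B \<V> \<inter> Y) ?C"
    proof
      fix y assume "y \<in> D"
      then obtain V c S z where y: "y \<in> Y" "V \<in> \<V>" "\<phi> y \<in> V" "c \<in> V" and
        S: "S \<in> \<C>" "c \<in> S" "z \<in> S" "z \<in> B"
        unfolding D star_def by blast
      \<comment> \<open>The point \<open>y'\<close> replaces the possibly unattained
        \<open>z\<close>: both \<open>y\<close> and \<open>y'\<close> lie in the preimage of
        \<open>star S \<V>\<close>, and \<open>y'\<close> also lies in that of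
        \<open>star B \<V>\<close>.\<close>
      have "z \<in> Z"
        using S(1,3) C by blast
      then obtain T y' where T: "T \<in> \<V>" "y' \<in> Y" "z \<in> T" "\<phi> y' \<in> T"
        using hit by blast
      have "\<phi> y \<in> star S \<V>" "\<phi> y' \<in> star S \<V>" "\<phi> y' \<in> star B \<V>"
        using y S T by (auto intro: starI)
      moreover have "\<phi> -` star S \<V> \<inter> Y \<in> ?C"
        using S(1) unfolding preimage_family_def star_family_def by blast
      ultimately show "y \<in> star (\<phi> -` star B \<V> \<inter> Y) ?C"
        using y(1) T(2) by (intro starI[of "\<phi> -` star S \<V> \<inter> Y" _ _ y']) auto
    qed
    then show "\<exists>E \<in> star_family ?B ?C. D \<subseteq> E"
      using \<open>B \<in> \<B>\<close> unfolding preimage_family_def star_family_def by blast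
  qed (auto simp: preimage_family_def)
  moreover have "star B \<C> \<subseteq> Z" for B
    using C unfolding star_def by blast
  ultimately show "star_family \<B> \<C> \<in> ?P"
    unfolding star_family_def by blast
qed blast

lemma weak_coarse_quotient_cancel_left:
  assumes LX: "large_scale_structure X \<X>" and LY: "large_scale_structure Y \<Y>"
    and LZ: "large_scale_structure Z \<Z>"
    and f: "large_scale_continuous X \<X> Y \<Y> f" and phi: "coarse_equivalence Y \<Y> Z \<Z> \<phi>"
    and wcq: "weak_coarse_quotient X \<X> Z \<Z> (\<phi> \<circ> f)"
  shows "weak_coarse_quotient X \<X> Y \<Y> f"
proof -
  have fD: "f \<in> X \<rightarrow> Y" "\<And>\<U>. \<U> \<in> \<X> \<Longrightarrow> image_family f \<U> \<in> \<Y>"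
    using f unfolding large_scale_continuous_def by auto
  have csphi: "coarsely_surjective Y \<Y> Z \<Z> \<phi>" and
    pre: "\<And>\<V>. \<V> \<in> \<Z> \<Longrightarrow> preimage_family Y \<phi> \<V> \<in> \<Y>"
    using phi unfolding coarse_equivalence_def by auto
  note phiD = coarsely_surjectiveD[OF csphi]
  obtain \<A> where cs: "coarsely_surjective X \<X> Z \<Z> (\<phi> \<circ> f)" and A: "\<A> \<in> \<Z>" and cover: "\<Union>\<A> = Z" and
    min: "\<And>\<Z>'. \<lbrakk>large_scale_structure Z \<Z>'; \<A> \<in> \<Z>'; \<And>\<U>. \<U> \<in> \<X> \<Longrightarrow> image_family (\<phi> \<circ> f) \<U> \<in> \<Z>'\<rbrakk>
      \<Longrightarrow> \<Z> \<subseteq> \<Z>'"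
    using weak_coarse_quotient_obtains[OF wcq] by blast
  obtain \<B> where B: "\<B> \<in> \<Z>" and
    hit: "\<And>z. z \<in> Z \<Longrightarrow> \<exists>V \<in> \<B>. \<exists>x \<in> X. z \<in> V \<and> (\<phi> \<circ> f) x \<in> V"
    using coarsely_surjective_obtains[OF cs] by blast
  \<comment> \<open>\<open>\<B>\<close> gives nearby points of \<open>\<phi>(Y)\<close>. Having
    \<open>\<A>\<close> inside \<open>\<V>\<close> makes its thickenings members of
    \<open>star_family \<V> \<V>\<close>, which later yields \<open>\<A> \<in> P\<close>.\<close>
  define \<V> where "\<V> = \<A> \<union> \<B>"
  have V: "\<V> \<in> \<Z>"
    unfolding \<V>_def by (rule uniformly_bounded_Un[OF LZ A B])
  have coverV: "\<Union>\<V> = Z"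
    using cover uniformly_bounded_subset[OF LZ V] unfolding \<V>_def by blast
  have hitV: "\<exists>V \<in> \<V>. \<exists>y \<in> Y. z \<in> V \<and> \<phi> y \<in> V" if z: "z \<in> Z" for z
  proof -
    obtain V x where Vx: "V \<in> \<B>" "x \<in> X" "z \<in> V" "\<phi> (f x) \<in> V"
      using hit[OF z] by auto
    then show ?thesis
      using fD(1) unfolding \<V>_def by blast
  qed
  have "coarsely_surjective X \<X> Y \<Y> f"
  proof (rule coarsely_surjectiveI[OF fD pre[OF B]])
    fix y assume y: "y \<in> Y"
    then obtain V x where Vx: "V \<in> \<B>" "x \<in> X" "\<phi> y \<in> V" "\<phi> (f x) \<in> V"
      using hit[of "\<phi> y"] phiD(1) by auto
    then show "\<exists>V \<in> preimage_family Y \<phi> \<B>. \<exists>x \<in> X. y \<in> V \<and> f x \<in> V"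
      using y fD(1) unfolding preimage_family_def by blast
  qed
  \<comment> \<open>This is the generating witness for \<open>f\<close>, chosen so that every
    competing \<open>\<Y>'\<close> admits the transported structure on \<open>Z\<close>.\<close>
  moreover have "preimage_family Y \<phi> (star_family \<V> \<V>) \<in> \<Y>"
    by (intro pre large_scale_structure_star[OF LZ] V)
  ultimately show ?thesis
  proof (rule weak_coarse_quotientI[OF LY], intro subsetI)
    fix \<Y>' \<D> assume L': "large_scale_structure Y \<Y>'" and
      V': "preimage_family Y \<phi> (star_family \<V> \<V>) \<in> \<Y>'" and
      im: "\<And>\<U>. \<U> \<in> \<X> \<Longrightarrow> image_family f \<U> \<in> \<Y>'" and D: "\<D> \<in> \<Y>"
    define P where "P = {\<B> \<in> Pow (Pow Z). preimage_family Y \<phi> (star_family \<B> \<V>) \<in> \<Y>'}"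
    have preV': "preimage_family Y \<phi> \<V> \<in> \<Y>'"
    proof (rule uniformly_bounded_refine[OF L' V'])
      fix C assume "C \<in> preimage_family Y \<phi> \<V>"
      then obtain V where C: "C = \<phi> -` V \<inter> Y" and "V \<in> \<V>"
        unfolding preimage_family_def by blast
      then have "V \<subseteq> star V \<V>"
        by (intro subset_star) blast
      then have "C \<subseteq> \<phi> -` star V \<V> \<inter> Y"
        unfolding C by blast
      moreover have "\<phi> -` star V \<V> \<inter> Y \<in> preimage_family Y \<phi> (star_family \<V> \<V>)"
        using \<open>V \<in> \<V>\<close> unfolding preimage_family_def star_family_def by blast
      ultimately show "\<exists>B \<in> preimage_family Y \<phi> (star_family \<V> \<V>). C \<subseteq> B"
        by blast
    qed (auto simp: preimage_family_def)
    have "\<Z> \<subseteq> P"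
    proof (rule min)
      show "large_scale_structure Z P"
        unfolding P_def by (rule large_scale_structure_pushforward[OF L' coverV hitV V'])
      have "preimage_family Y \<phi> (star_family \<A> \<V>) \<in> \<Y>'"
        by (rule uniformly_bounded_refine[OF L' V'])
          (auto simp: preimage_family_def star_family_def \<V>_def)
      then show "\<A> \<in> P"
        using cover unfolding P_def by blast
    next
      fix \<U> assume U: "\<U> \<in> \<X>"
      have sub: "image_family (\<phi> \<circ> f) \<U> \<in> Pow (Pow Z)"
        using uniformly_bounded_subset[OF LZ coarsely_surjectiveD(2)[OF cs U]] by blast
      have "preimage_family Y \<phi> (star_family (image_family (\<phi> \<circ> f) \<U>) \<V>) \<in> \<Y>'"
      proof (rule uniformly_bounded_refine[OF L' large_scale_structure_star[OF L' im[OF U] preV']])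
        fix C assume "C \<in> preimage_family Y \<phi> (star_family (image_family (\<phi> \<circ> f) \<U>) \<V>)"
        then obtain S where C: "C = \<phi> -` star ((\<phi> \<circ> f) ` S) \<V> \<inter> Y" and S: "S \<in> \<U>"
          unfolding preimage_family_def star_family_def image_family_def by blast
        \<comment> \<open>If \<open>\<phi> y\<close> and \<open>\<phi> (f s)\<close> share a member
          of \<open>\<V>\<close>, then \<open>y\<close> and \<open>f s\<close> share its
          preimage.\<close>
        have "C \<subseteq> star (f ` S) (preimage_family Y \<phi> \<V>)"
        proof
          fix y assume "y \<in> C"
          then obtain V s where "y \<in> Y" "V \<in> \<V>" "\<phi> y \<in> V" "s \<in> S" "\<phi> (f s) \<in> V"
            unfolding C star_def by auto
          moreover have "f s \<in> Y"
            using \<open>s \<in> S\<close> uniformly_bounded_subset[OF LX U S] fD(1) by blast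
          ultimately show "y \<in> star (f ` S) (preimage_family Y \<phi> \<V>)"
            by (intro starI[of "\<phi> -` V \<inter> Y" _ _ "f s"]) (auto simp: preimage_family_def)
        qed
        then show "\<exists>B \<in> star_family (image_family f \<U>) (preimage_family Y \<phi> \<V>). C \<subseteq> B"
          using S unfolding star_family_def image_family_def by blast
      qed (auto simp: preimage_family_def)
      then show "image_family (\<phi> \<circ> f) \<U> \<in> P"
        using sub unfolding P_def by blast
    qed
    \<comment> \<open>As \<open>\<phi>(\<D>)\<close> lies in \<open>\<Z>\<close> and hence in
      \<open>P\<close>, its thickened preimages are bounded in \<open>\<Y>'\<close>, and they
      contain the members of \<open>\<D>\<close>.\<close>
    then have "preimage_family Y \<phi> (star_family (image_family \<phi> \<D>) \<V>) \<in> \<Y>'"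
      using phiD(2)[OF D] unfolding P_def by blast
    then show "\<D> \<in> \<Y>'"
    proof (rule uniformly_bounded_refine[OF L'])
      fix C assume C: "C \<in> \<D>"
      then show CY: "C \<subseteq> Y"
        by (rule uniformly_bounded_subset[OF LY D])
      have "\<phi> ` C \<subseteq> star (\<phi> ` C) \<V>"
        using CY phiD(1) coverV by (intro subset_star) blast
      then have "C \<subseteq> \<phi> -` star (\<phi> ` C) \<V> \<inter> Y"
        using CY by blast
      then show "\<exists>B \<in> preimage_family Y \<phi> (star_family (image_family \<phi> \<D>) \<V>). C \<subseteq> B"
        using C unfolding preimage_family_def star_family_def image_family_def by blast
    qed
  qed
qed

section \<open>Composition with coarse equivalences on both sides (LS2)\<close>

lemma large_scale_continuous_comp:
  assumes "large_scale_continuous X \<X> Y \<Y> f" "large_scale_continuous Y \<Y> Z \<Z> g"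
  shows "large_scale_continuous X \<X> Z \<Z> (g \<circ> f)"
  using assms unfolding large_scale_continuous_def by (auto simp: image_family_comp)

text \<open>Forwards, all three maps are weak coarse quotient maps and these compose. Backwards,
  \<open>\<psi>\<close> is cancelled from \<open>(\<phi> \<circ> f) \<circ> \<psi>\<close> first,
  then \<open>\<phi>\<close>.\<close>

lemma weak_coarse_quotient_coarse_equivalence_iff:
  assumes LX: "large_scale_structure X \<X>" and LY: "large_scale_structure Y \<Y>"
    and LZ: "large_scale_structure Z \<Z>"
    and psi: "coarse_equivalence W \<W> X \<X> \<psi>" and f: "large_scale_continuous X \<X> Y \<Y> f"
    and phi: "coarse_equivalence Y \<Y> Z \<Z> \<phi>"
  shows "weak_coarse_quotient X \<X> Y \<Y> f \<longleftrightarrow> weak_coarse_quotient W \<W> Z \<Z> (\<phi> \<circ> f \<circ> \<psi>)"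
proof
  assume "weak_coarse_quotient X \<X> Y \<Y> f"
  then have "weak_coarse_quotient X \<X> Z \<Z> (\<phi> \<circ> f)"
    using coarse_equivalence_imp_weak_coarse_quotient[OF LZ phi]
    by (rule weak_coarse_quotient_comp[OF LY LZ])
  with coarse_equivalence_imp_weak_coarse_quotient[OF LX psi]
  show "weak_coarse_quotient W \<W> Z \<Z> (\<phi> \<circ> f \<circ> \<psi>)"
    by (rule weak_coarse_quotient_comp[OF LX LZ])
next
  assume wcq: "weak_coarse_quotient W \<W> Z \<Z> (\<phi> \<circ> f \<circ> \<psi>)"
  have psi': "large_scale_continuous W \<W> X \<X> \<psi>" and phi': "large_scale_continuous Y \<Y> Z \<Z> \<phi>"
    using psi phi unfolding coarse_equivalence_def coarsely_surjective_def by auto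
  have "weak_coarse_quotient X \<X> Z \<Z> (\<phi> \<circ> f)"
    by (rule weak_coarse_quotient_cancel_right[OF LZ psi' large_scale_continuous_comp[OF f phi'] wcq])
  then show "weak_coarse_quotient X \<X> Y \<Y> f"
    by (rule weak_coarse_quotient_cancel_left[OF LX LY LZ f phi])
qed

theorem corollary6p8:
  shows "(\<forall>(X :: 'a set) \<X> (Y :: 'b set) \<Y> f.
            large_scale_structure X \<X> \<longrightarrow> large_scale_structure Y \<Y> \<longrightarrow>
            coarse_equivalence X \<X> Y \<Y> f \<longrightarrow> weak_coarse_quotient X \<X> Y \<Y> f)
       \<and> (\<forall>(X :: 'a set) \<X> (Y :: 'b set) \<Y> f g.
            large_scale_structure X \<X> \<longrightarrow> large_scale_structure Y \<Y> \<longrightarrow>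
            close_maps X Y \<Y> f g \<longrightarrow>
            weak_coarse_quotient X \<X> Y \<Y> f \<longrightarrow> weak_coarse_quotient X \<X> Y \<Y> g)
       \<and> (\<forall>(W :: 'c set) \<W> (X :: 'a set) \<X> (Y :: 'b set) \<Y> (Z :: 'd set) \<Z> \<psi> f \<phi>.
            large_scale_structure W \<W> \<longrightarrow> large_scale_structure X \<X> \<longrightarrow>
            large_scale_structure Y \<Y> \<longrightarrow> large_scale_structure Z \<Z> \<longrightarrow>
            coarse_equivalence W \<W> X \<X> \<psi> \<longrightarrow> large_scale_continuous X \<X> Y \<Y> f \<longrightarrow>
            coarse_equivalence Y \<Y> Z \<Z> \<phi> \<longrightarrow>
            (weak_coarse_quotient X \<X> Y \<Y> f \<longleftrightarrow>
             weak_coarse_quotient W \<W> Z \<Z> (\<phi> \<circ> f \<circ> \<psi>)))"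
proof (intro conjI allI impI)
qed (rule coarse_equivalence_imp_weak_coarse_quotient weak_coarse_quotient_close
    weak_coarse_quotient_coarse_equivalence_iff; assumption)+

end
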